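(* Let $n$ be a positive integer and let $S, T \subseteq [n]$ with $|S|=|T|$. Then $$\sum_{P \in P_n(S,T)} y^{\mathrm{cr}_2(P)} = \prod_{i \in [n]\setminus T} \left(1+y+\cdots+y^{h(i)-1}\right),$$ where $h(i)=|T\cap\{i+1,\dots,n\}|-|S\cap\{i+1,\dots,n\}|$.
   Context: $[n]=\{1,2,\dots,n\}$, and $\Pi_n$ is the set of all set partitions of $[n]$. For $P\in\Pi_n$, the standard representation of $P$ is the graph on vertex set $[n]$ whose edges (arcs) are the pairs $(i,j)$, $i<j$, such that $i$ and $j$ are consecutive elements (in numerical order) of the same block of $P$. For example, $P=1457\text{-}26\text{-}3$ has arcs $(1,4),(4,5),(5,7),(2,6)$. Two arcs $(i_1,j_1),(i_2,j_2)$ form a 2-crossing if $i_1<i_2<j_1<j_2$; $\mathrm{cr}_2(P)$ is the number of 2-crossings of the standard representation of $P$. $\min(P)$ is the set of minimal elements of the blocks of $P$, and $\max(P)$ is the set of maximal elements of the blocks of $P$. For $S,T\subseteq[n]$, $P_n(S,T)=\{P\in\Pi_n:\min(P)=S,\ \max(P)=T\}$ (possibly empty). Here $y$ is an indeterminate. The factor $1+y+\cdots+y^{h(i)-1}$ means $\sum_{0\le k\le h(i)-1}y^k$, which is the empty sum $0$ if $h(i)\le 0$. *)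

theory Defs
  imports "HOL-Library.Disjoint_Sets" "HOL-Computational_Algebra.Polynomial"
begin

definition set_partitions :: "nat \<Rightarrow> nat set set set" where
  "set_partitions n = {P. partition_on {1..n} P}"

text \<open>The edges of the standard representation of \<open>P\<close>, each written as \<open>(i, j)\<close> with \<open>i < j\<close>.\<close>

definition arcs :: "nat set set \<Rightarrow> (nat \<times> nat) set" where
  "arcs P = {(i, j). i < j \<and> (\<exists>B\<in>P. i \<in> B \<and> j \<in> B \<and> (\<forall>k\<in>B. \<not> (i < k \<and> k < j)))}"

text \<open>The condition \<open>i1 < i2\<close> orders the two arcs, so each crossing pair is counted once.\<close>

definition cr2 :: "nat set set \<Rightarrow> nat" where
  "cr2 P = card {((i1, j1), (i2, j2)).
     (i1, j1) \<in> arcs P \<and> (i2, j2) \<in> arcs P \<and> i1 < i2 \<and> i2 < j1 \<and> j1 < j2}"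

definition mins :: "nat set set \<Rightarrow> nat set" where
  "mins P = Min ` P"

definition maxs :: "nat set set \<Rightarrow> nat set" where
  "maxs P = Max ` P"

definition partitions_min_max :: "nat \<Rightarrow> nat set \<Rightarrow> nat set \<Rightarrow> nat set set set" where
  "partitions_min_max n S T = {P \<in> set_partitions n. mins P = S \<and> maxs P = T}"

definition h :: "nat \<Rightarrow> nat set \<Rightarrow> nat set \<Rightarrow> nat \<Rightarrow> int" where
  "h n S T i = int (card (T \<inter> {i+1..n})) - int (card (S \<inter> {i+1..n}))"

text \<open>The indeterminate.\<close>

definition y :: "int poly" where
  "y = [:0, 1:]"

end

theory Submission imports Defs begin

text \<open>
  A set partition of \<open>V = {1..n}\<close> is determined by its arcs. Within a block, every element except
  the maximum starts exactly one arc and every element except the minimum ends exactly one. So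
  the arcs of a partition with block minima \<open>S\<close> and block maxima \<open>T\<close> form a bijection from
  the openers \<open>L = V - T\<close> onto the closers \<open>R = V - S\<close> in which every opener lies left of
  its closer; conversely, following the arcs of any such bijection cuts \<open>V\<close> into chains, which are
  the blocks of a partition with these arcs (lemma \<open>bij_betw_arcs\<close>). The theorem is therefore
  a count, by crossings, of these bijections.

  To count them, let the openers choose their closers from right to left. An opener \<open>i\<close> may take
  any closer to its right that no larger opener has taken. Each larger opener has taken one
  closer, necessarily to the right of \<open>i\<close>, so the number of candidates is the number of closers
  beyond \<open>i\<close> minus the number of openers beyond \<open>i\<close>, which is \<open>h i\<close>. Suppose that \<open>i\<close>
  takes the candidate \<open>j\<close>. The \<open>k\<close> candidates strictly between \<open>i\<close> and \<open>j\<close> will be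
  taken by smaller openers, and the arcs ending there are exactly the arcs that \<open>(i, j)\<close> crosses
  as the right-hand member of a crossing. As \<open>j\<close> runs through the candidates, \<open>k\<close>
  runs through \<open>0, \<dots>, h i - 1\<close>. Every crossing has one right-hand member, so the choice of
  \<open>i\<close> contributes the factor \<open>1 + y + \<cdots> + y ^ (h i - 1)\<close> independently of the other choices. In
  the induction behind \<open>sum_crossings_arc_diagrams\<close> the largest opener chooses first and its arc
  is then removed.
\<close>

section \<open>Arc diagrams counted by crossings\<close>

text \<open>
  The bijections from \<open>L\<close> onto \<open>R\<close> that send every point to a larger one, as sets of pairs:
  this is the form in which \<open>arcs\<close> presents them, and an arc is removed by a set difference.
\<close>

definition arc_diagrams :: "nat set \<Rightarrow> nat set \<Rightarrow> (nat \<times> nat) set set" where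
  "arc_diagrams L R = {A. Domain A = L \<and> Range A = R \<and> single_valued A \<and> single_valued (A\<inverse>)
     \<and> (\<forall>(i, j)\<in>A. i < j)}"

definition crossings :: "(nat \<times> nat) set \<Rightarrow> ((nat \<times> nat) \<times> (nat \<times> nat)) set" where
  "crossings A = {((i1, j1), (i2, j2)).
     (i1, j1) \<in> A \<and> (i2, j2) \<in> A \<and> i1 < i2 \<and> i2 < j1 \<and> j1 < j2}"

lemma cr2_eq_card_crossings: "cr2 P = card (crossings (arcs P))"
  by (simp add: cr2_def crossings_def)

lemma arc_diagramsD:
  assumes "A \<in> arc_diagrams L R"
  shows "Domain A = L" "Range A = R" "A \<subseteq> L \<times> R"
    "\<And>i j j'. (i, j) \<in> A \<Longrightarrow> (i, j') \<in> A \<Longrightarrow> j = j'"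
    "\<And>i i' j. (i, j) \<in> A \<Longrightarrow> (i', j) \<in> A \<Longrightarrow> i = i'"
    "\<And>i j. (i, j) \<in> A \<Longrightarrow> i < j"
  using assms by (auto simp: arc_diagrams_def single_valued_def)

lemma finite_arc_diagrams:
  assumes "finite L" "finite R"
  shows "finite (arc_diagrams L R)"
proof (rule finite_subset)
  show "arc_diagrams L R \<subseteq> Pow (L \<times> R)"
    by (auto simp: arc_diagrams_def)
  show "finite (Pow (L \<times> R))"
    using assms by simp
qed

lemma arc_diagrams_empty_left: "arc_diagrams {} R = (if R = {} then {{}} else {})"
  by (auto simp: arc_diagrams_def)

text \<open>
  The elements of \<open>X\<close> have the ranks \<open>0, \<dots>, card X - 1\<close>, each once. This turns the choice of a
  closer into a geometric sum.
\<close>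

lemma sum_power_rank:
  fixes q :: "'a::comm_semiring_1" and X :: "nat set"
  assumes "finite X"
  shows "(\<Sum>j\<in>X. q ^ card {x\<in>X. x < j}) = (\<Sum>k<card X. q ^ k)"
  using assms
proof (induction X rule: finite_linorder_max_induct)
  case (insert b X)
  have "b \<notin> X"
    using insert.hyps by auto
  have "{x \<in> insert b X. x < b} = X"
    using insert.hyps by auto
  moreover have "{x \<in> insert b X. x < j} = {x \<in> X. x < j}" if "j \<in> X" for j
    using insert.hyps that by auto
  ultimately show ?case
    using insert \<open>b \<notin> X\<close> by (simp add: add.commute)
qed simp

lemma insert_arc_in_arc_diagrams:
  assumes "A \<in> arc_diagrams (L - {i}) (R - {j})" "i \<in> L" "j \<in> R" "i < j"
  shows "insert (i, j) A \<in> arc_diagrams L R"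
  using assms by (auto simp: arc_diagrams_def single_valued_def)

lemma remove_arc_in_arc_diagrams:
  assumes "A \<in> arc_diagrams L R" "(i, j) \<in> A"
  shows "A - {(i, j)} \<in> arc_diagrams (L - {i}) (R - {j})"
  using assms unfolding arc_diagrams_def single_valued_def by auto

text \<open>
  A diagram is the choice of the closer \<open>j\<close> for one fixed opener \<open>i\<close> followed by a diagram on
  the remaining points.
\<close>

lemma arc_diagrams_Max_decomposition:
  assumes "i \<in> L"
  shows "bij_betw (\<lambda>(j, A). insert (i, j) A)
    (SIGMA j:{j\<in>R. i < j}. arc_diagrams (L - {i}) (R - {j})) (arc_diagrams L R)"
proof (rule bij_betwI')
  fix u v
  assume "u \<in> (SIGMA j:{j\<in>R. i < j}. arc_diagrams (L - {i}) (R - {j}))"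
    "v \<in> (SIGMA j:{j\<in>R. i < j}. arc_diagrams (L - {i}) (R - {j}))"
  then obtain j A j' A' where uv: "u = (j, A)" "v = (j', A')"
    and A: "A \<in> arc_diagrams (L - {i}) (R - {j})" and A': "A' \<in> arc_diagrams (L - {i}) (R - {j'})"
    by auto
  have new: "(i, k) \<notin> A" "(i, k) \<notin> A'" for k
    using arc_diagramsD(3)[OF A] arc_diagramsD(3)[OF A'] by auto
  have "j = j' \<and> A = A'" if eq: "insert (i, j) A = insert (i, j') A'"
  proof -
    have "j = j'"
      using eq new(2)[of j] by (metis Pair_inject insert_iff)
    moreover have "A = insert (i, j) A - {(i, j)}" "A' = insert (i, j') A' - {(i, j')}"
      using new by auto
    ultimately show ?thesis
      using eq by metis
  qed
  then show "((case u of (j, A) \<Rightarrow> insert (i, j) A) = (case v of (j, A) \<Rightarrow> insert (i, j) A)) = (u = v)"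
    using uv by auto
next
  fix u assume "u \<in> (SIGMA j:{j\<in>R. i < j}. arc_diagrams (L - {i}) (R - {j}))"
  then show "(case u of (j, A) \<Rightarrow> insert (i, j) A) \<in> arc_diagrams L R"
    using assms by (auto intro: insert_arc_in_arc_diagrams)
next
  fix A assume A: "A \<in> arc_diagrams L R"
  then obtain j where j: "(i, j) \<in> A"
    using assms by (auto simp: arc_diagrams_def)
  show "\<exists>u\<in>SIGMA j:{j\<in>R. i < j}. arc_diagrams (L - {i}) (R - {j}).
      A = (case u of (j, A) \<Rightarrow> insert (i, j) A)"
    using remove_arc_in_arc_diagrams[OF A j] arc_diagramsD(3,6)[OF A] j
    by (intro bexI[of _ "(j, A - {(i, j)})"]) auto
qed

text \<open>
  The arc \<open>(i, j)\<close> of the largest opener is never the left-hand member of a crossing. It is the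
  right-hand member once for each arc that ends strictly between \<open>i\<close> and \<open>j\<close>, because such an
  arc starts left of \<open>i\<close>; and every closer between \<open>i\<close> and \<open>j\<close> ends an arc.
\<close>

lemma card_crossings_insert_Max:
  assumes A: "A \<in> arc_diagrams (L - {i}) (R - {j})" and fin: "finite L" "finite R"
    and max: "\<And>l. l \<in> L \<Longrightarrow> l \<le> i"
  shows "card (crossings (insert (i, j) A)) = card {x\<in>{x\<in>R. i < x}. x < j} + card (crossings A)"
proof -
  note D = arc_diagramsD[OF A]
  \<comment> \<open>the crossings in which the new arc takes part\<close>
  define N where "N = {((i1, j1), (i, j)) |i1 j1. (i1, j1) \<in> A \<and> i < j1 \<and> j1 < j}"
  have left: "l < i" if "(l, r) \<in> A" for l r
    using D(3) max[of l] that by fastforce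
  have "finite A"
    using D(3) fin by (meson finite_Diff finite_SigmaI finite_subset)
  have "crossings A \<subseteq> A \<times> A" "N \<subseteq> A \<times> {(i, j)}"
    by (auto simp: crossings_def N_def)
  then have finite: "finite (crossings A)" "finite N"
    using \<open>finite A\<close> by (meson finite.emptyI finite_insert finite_SigmaI finite_subset)+
  have split: "crossings (insert (i, j) A) = N \<union> crossings A"
    using left by (fastforce simp: crossings_def N_def)
  have disjoint: "N \<inter> crossings A = {}"
    using left by (fastforce simp: crossings_def N_def)
  have "bij_betw (\<lambda>a. snd (fst a)) N {x\<in>{x\<in>R. i < x}. x < j}"
    unfolding bij_betw_def
  proof
    show "inj_on (\<lambda>a. snd (fst a)) N"
      using D(5) by (auto simp: inj_on_def N_def)
    show "(\<lambda>a. snd (fst a)) ` N = {x\<in>{x\<in>R. i < x}. x < j}"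
    proof
      show "(\<lambda>a. snd (fst a)) ` N \<subseteq> {x\<in>{x\<in>R. i < x}. x < j}"
        using D(3) by (auto simp: N_def)
      show "{x\<in>{x\<in>R. i < x}. x < j} \<subseteq> (\<lambda>a. snd (fst a)) ` N"
      proof
        fix x assume x: "x \<in> {x\<in>{x\<in>R. i < x}. x < j}"
        then have "x \<in> Range A"
          using D(2) by auto
        then obtain l where "(l, x) \<in> A"
          by auto
        then have "((l, x), (i, j)) \<in> N"
          using x by (auto simp: N_def)
        then show "x \<in> (\<lambda>a. snd (fst a)) ` N"
          by force
      qed
    qed
  qed
  then have "card N = card {x\<in>{x\<in>R. i < x}. x < j}"
    by (rule bij_betw_same_card)
  with split disjoint finite show ?thesis
    by (simp add: card_Un_disjoint)
qed

text \<open>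
  Induction on \<open>L\<close> by removing its largest element \<open>i\<close>. Whatever closer \<open>j\<close> is chosen for
  \<open>i\<close>, both points lie to the right of every remaining opener, so their removal lowers
  the two cardinalities in each remaining factor by one and keeps their difference. The sum over
  the rest is therefore the same for all \<open>j\<close>, and the sum over \<open>j\<close> splits off as the factor
  of \<open>i\<close>. The equality of the cardinalities matters when \<open>L\<close> is empty: then the product is
  \<open>1\<close>, whereas a diagram exists only if \<open>R\<close> is empty too.
\<close>

theorem sum_crossings_arc_diagrams:
  fixes q :: "'a::comm_semiring_1"
  assumes "finite L" "finite R" "card L = card R"
  shows "(\<Sum>A\<in>arc_diagrams L R. q ^ card (crossings A)) =
    (\<Prod>i\<in>L. \<Sum>k<card {j\<in>R. i < j} - card {l\<in>L. i < l}. q ^ k)"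
  using assms
proof (induction L arbitrary: R rule: finite_linorder_max_induct)
  case empty
  moreover have "crossings {} = {}"
    by (auto simp: crossings_def)
  ultimately show ?case
    by (simp add: arc_diagrams_empty_left)
next
  case (insert i L)
  let ?Ri = "{j\<in>R. i < j}"
  have i: "i \<notin> L" "insert i L - {i} = L"
    using insert.hyps by auto
  have IH: "(\<Sum>A\<in>arc_diagrams L (R - {j}). q ^ card (crossings A)) =
      (\<Prod>l\<in>L. \<Sum>k<card {r\<in>R. l < r} - card {m\<in>insert i L. l < m}. q ^ k)"
    if j: "j \<in> ?Ri" for j
  proof -
    have "card {r\<in>R - {j}. l < r} - card {m\<in>L. l < m} =
        card {r\<in>R. l < r} - card {m\<in>insert i L. l < m}" if l: "l \<in> L" for l
    proof -
      have "l < i" "l < j"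
        using l j insert.hyps by force+
      have "{r\<in>R. l < r} = insert j {r\<in>R - {j}. l < r}"
        "{m\<in>insert i L. l < m} = insert i {m\<in>L. l < m}"
        using j \<open>l < i\<close> \<open>l < j\<close> by auto
      \<comment> \<open>Both cardinalities on the right are successors, so the truncated difference is unaffected.\<close>
      moreover have "card (insert j {r\<in>R - {j}. l < r}) = Suc (card {r\<in>R - {j}. l < r})"
        "card (insert i {m\<in>L. l < m}) = Suc (card {m\<in>L. l < m})"
        using insert.prems insert.hyps i by (auto intro!: card_insert_disjoint)
      ultimately show ?thesis
        by simp
    qed
    moreover have "card L = card (R - {j})"
      using insert.prems insert.hyps i j by simp
    ultimately show ?thesis
      using insert.IH[of "R - {j}"] insert.prems by simp
  qed
  have weight: "card (crossings (insert (i, j) A)) = card {x\<in>?Ri. x < j} + card (crossings A)"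
    if "A \<in> arc_diagrams L (R - {j})" for j A
  proof (rule card_crossings_insert_Max)
    show "A \<in> arc_diagrams (insert i L - {i}) (R - {j})"
      using that i by simp
    show "finite (insert i L)" "finite R"
      using insert.hyps insert.prems by auto
    show "l \<le> i" if "l \<in> insert i L" for l
      using that insert.hyps by force
  qed
  have "(\<Sum>A\<in>arc_diagrams (insert i L) R. q ^ card (crossings A)) =
      (\<Sum>(j, A)\<in>(SIGMA j:?Ri. arc_diagrams L (R - {j})). q ^ card (crossings (insert (i, j) A)))"
    using sum.reindex_bij_betw[OF arc_diagrams_Max_decomposition[of i "insert i L" R],
        of "\<lambda>A. q ^ card (crossings A)"] i
    by (simp add: case_prod_unfold)
  also have "\<dots> = (\<Sum>j\<in>?Ri. \<Sum>A\<in>arc_diagrams L (R - {j}). q ^ card (crossings (insert (i, j) A)))"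
    using insert.prems insert.hyps by (intro sum.Sigma[symmetric]) (auto intro: finite_arc_diagrams)
  also have "\<dots> = (\<Sum>j\<in>?Ri. q ^ card {x\<in>?Ri. x < j} *
      (\<Sum>A\<in>arc_diagrams L (R - {j}). q ^ card (crossings A)))"
    by (intro sum.cong refl) (simp add: weight power_add sum_distrib_left)
  also have "\<dots> = (\<Sum>j\<in>?Ri. q ^ card {x\<in>?Ri. x < j}) *
      (\<Prod>l\<in>L. \<Sum>k<card {r\<in>R. l < r} - card {m\<in>insert i L. l < m}. q ^ k)"
    using IH by (simp add: sum_distrib_right)
  also have "(\<Sum>j\<in>?Ri. q ^ card {x\<in>?Ri. x < j}) = (\<Sum>k<card ?Ri. q ^ k)"
    using insert.prems by (intro sum_power_rank) simp
  \<comment> \<open>No opener exceeds \<open>i\<close>, so all closers beyond \<open>i\<close> are candidates.\<close>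
  also have "card ?Ri = card ?Ri - card {m\<in>insert i L. i < m}"
  proof -
    have "{m\<in>insert i L. i < m} = {}"
      using insert.hyps by force
    then show ?thesis
      by (simp only: card.empty diff_zero)
  qed
  finally show ?case
    using insert.hyps i by simp
qed

section \<open>The arcs of a partition\<close>

lemma arcs_in_block:
  assumes "disjoint P" "(i, j) \<in> arcs P" "B \<in> P"
  shows "i \<in> B \<longleftrightarrow> j \<in> B"
proof -
  obtain C where "C \<in> P" "i \<in> C" "j \<in> C"
    using assms(2) by (auto simp: arcs_def)
  with assms(1,3) show ?thesis
    by (auto dest: disjointD)
qed

lemma next_in_block:
  assumes "B \<in> P" "finite B" "i \<in> B" "x \<in> B" "i < x"
  obtains j where "(i, j) \<in> arcs P" "j \<in> B" "j \<le> x"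
proof -
  define j where "j = Min {k\<in>B. i < k}"
  have j: "j \<in> {k\<in>B. i < k}"
    unfolding j_def using assms by (intro Min_in) auto
  have least: "j \<le> k" if "k \<in> B" "i < k" for k
    unfolding j_def using assms(2) that by (intro Min_le) auto
  then have "\<forall>k\<in>B. \<not> (i < k \<and> k < j)"
    by (meson not_le)
  with j assms(1,3) have "(i, j) \<in> arcs P"
    unfolding arcs_def by blast
  with j least[OF assms(4,5)] show ?thesis
    using that by blast
qed

lemma previous_in_block:
  assumes "B \<in> P" "finite B" "j \<in> B" "x \<in> B" "x < j"
  obtains i where "(i, j) \<in> arcs P" "i \<in> B"
proof -
  define i where "i = Max {k\<in>B. k < j}"
  have i: "i \<in> {k\<in>B. k < j}"
    unfolding i_def using assms by (intro Max_in) auto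
  have "k \<le> i" if "k \<in> B" "k < j" for k
    unfolding i_def using assms(2) that by (intro Max_ge) auto
  then have "\<forall>k\<in>B. \<not> (i < k \<and> k < j)"
    by (meson not_le)
  with i assms(1,3) have "(i, j) \<in> arcs P"
    unfolding arcs_def by blast
  with i show ?thesis
    using that by blast
qed

lemma partition_on_finite_block:
  assumes "partition_on V P" "finite V" "B \<in> P"
  shows "finite B"
  using assms partition_onD1[OF assms(1)] by (metis Sup_upper finite_subset)

lemma Domain_arcs:
  assumes P: "partition_on V P" and V: "finite V"
  shows "Domain (arcs P) = V - maxs P"
proof
  note fin = partition_on_finite_block[OF P V]
  show "Domain (arcs P) \<subseteq> V - maxs P"
  proof clarify
    fix i j assume ij: "(i, j) \<in> arcs P"
    then obtain B where B: "B \<in> P" "i \<in> B" "j \<in> B" "i < j"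
      by (auto simp: arcs_def)
    have "i \<noteq> Max C" if "C \<in> P" for C
    proof
      assume "i = Max C"
      then have "i \<in> C"
        using that fin partition_onD3[OF P] by (metis Max_in)
      then have "j \<in> C"
        using arcs_in_block[OF partition_onD2[OF P] ij that] by simp
      then show False
        using Max_ge[OF fin[OF that]] \<open>i = Max C\<close> \<open>i < j\<close> by fastforce
    qed
    then show "i \<in> V - maxs P"
      using B partition_onD1[OF P] by (auto simp: maxs_def)
  qed
  show "V - maxs P \<subseteq> Domain (arcs P)"
  proof
    fix i assume i: "i \<in> V - maxs P"
    then obtain B where B: "B \<in> P" "i \<in> B"
      using partition_onD1[OF P] by auto
    have "Max B \<in> B" "i \<le> Max B"
      using fin B by (auto intro: Max_in)
    moreover have "i \<noteq> Max B"
      using i B by (auto simp: maxs_def)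
    ultimately show "i \<in> Domain (arcs P)"
      using next_in_block[OF B(1) fin[OF B(1)] B(2), of "Max B"] by (metis DomainI le_neq_implies_less)
  qed
qed

lemma Range_arcs:
  assumes P: "partition_on V P" and V: "finite V"
  shows "Range (arcs P) = V - mins P"
proof
  note fin = partition_on_finite_block[OF P V]
  show "Range (arcs P) \<subseteq> V - mins P"
  proof clarify
    fix i j assume ij: "(i, j) \<in> arcs P"
    then obtain B where B: "B \<in> P" "i \<in> B" "j \<in> B" "i < j"
      by (auto simp: arcs_def)
    have "j \<noteq> Min C" if "C \<in> P" for C
    proof
      assume "j = Min C"
      then have "j \<in> C"
        using that fin partition_onD3[OF P] by (metis Min_in)
      then have "i \<in> C"
        using arcs_in_block[OF partition_onD2[OF P] ij that] by simp
      then show False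
        using Min_le[OF fin[OF that]] \<open>j = Min C\<close> \<open>i < j\<close> by fastforce
    qed
    then show "j \<in> V - mins P"
      using B partition_onD1[OF P] by (auto simp: mins_def)
  qed
  show "V - mins P \<subseteq> Range (arcs P)"
  proof
    fix j assume j: "j \<in> V - mins P"
    then obtain B where B: "B \<in> P" "j \<in> B"
      using partition_onD1[OF P] by auto
    have "Min B \<in> B" "Min B \<le> j"
      using fin B by (auto intro: Min_in)
    moreover have "Min B \<noteq> j"
      using j B by (auto simp: mins_def)
    ultimately show "j \<in> Range (arcs P)"
      using previous_in_block[OF B(1) fin[OF B(1)] B(2), of "Min B"] by (metis RangeI le_neq_implies_less)
  qed
qed

text \<open>
  If two arcs share an endpoint, disjointness puts both into one block, and neither of the two
  other endpoints can lie strictly inside the other arc; so the arcs agree.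
\<close>

lemma arcs_in_arc_diagrams:
  assumes P: "partition_on V P" and V: "finite V"
  shows "arcs P \<in> arc_diagrams (V - maxs P) (V - mins P)"
proof -
  have same: "\<exists>B\<in>P. {i, j, k} \<subseteq> B \<and> (\<forall>x\<in>B. \<not> (i < x \<and> x < j))"
    if arc: "(i, j) \<in> arcs P" and adj: "(i, k) \<in> arcs P \<or> (k, j) \<in> arcs P" for i j k
  proof -
    obtain B where B: "B \<in> P" "i \<in> B" "j \<in> B" "\<forall>x\<in>B. \<not> (i < x \<and> x < j)"
      using arc unfolding arcs_def by blast
    with adj arcs_in_block[OF partition_onD2[OF P] _ B(1)] show ?thesis
      by blast
  qed
  have less: "i < j" if "(i, j) \<in> arcs P" for i j
    using that by (auto simp: arcs_def)
  have "j = k" if "(i, j) \<in> arcs P" "(i, k) \<in> arcs P" for i j k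
    using same[of i j k] same[of i k j] less[of i j] less[of i k] that
    by (metis insert_subset linorder_neqE_nat)
  moreover have "i = k" if "(i, j) \<in> arcs P" "(k, j) \<in> arcs P" for i j k
    using same[of i j k] same[of k j i] less[of i j] less[of k j] that
    by (metis insert_subset linorder_neqE_nat)
  ultimately show ?thesis
    using Domain_arcs[OF P V] Range_arcs[OF P V] less
    by (auto simp: arc_diagrams_def single_valued_def)
qed

section \<open>The partition of an arc diagram\<close>

text \<open>
  Two points are related if one is reached from the other by following arcs forwards. For an arc
  diagram this already is the equivalence relation generated by the arcs, because its paths neither
  branch nor merge; and the form without mixed directions makes the order within a block visible.
\<close>

definition chain_rel :: "nat set \<Rightarrow> (nat \<times> nat) set \<Rightarrow> (nat \<times> nat) set" where
  "chain_rel V A = {(x, w). x \<in> V \<and> w \<in> V \<and> ((x, w) \<in> A\<^sup>* \<or> (w, x) \<in> A\<^sup>*)}"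

text \<open>
  Following arcs never leaves a block. Conversely, going from \<open>x\<close> to the next element of its
  block again and again reaches every larger element of the block.
\<close>

lemma chain_rel_arcs:
  assumes P: "partition_on V P" and V: "finite V"
  shows "chain_rel V (arcs P) = {(x, w). \<exists>B\<in>P. x \<in> B \<and> w \<in> B}"
proof -
  note fin = partition_on_finite_block[OF P V]
  have reach: "(x, w) \<in> (arcs P)\<^sup>*" if B: "B \<in> P" and "x \<in> B" "w \<in> B" "x \<le> w" for x w B
    using that(2-)
  proof (induction "w - x" arbitrary: x rule: less_induct)
    case less
    show ?case
    proof (cases "x = w")
      case False
      then obtain z where z: "(x, z) \<in> arcs P" "z \<in> B" "z \<le> w"
        using next_in_block[OF B fin[OF B], of x w] less.prems by auto
      moreover have "x < z"
        using z(1) by (auto simp: arcs_def)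
      ultimately have "(z, w) \<in> (arcs P)\<^sup>*"
        using less by simp
      with z(1) show ?thesis
        by (rule converse_rtrancl_into_rtrancl)
    qed simp
  qed
  have stay: "x \<in> B \<longleftrightarrow> w \<in> B" if "(x, w) \<in> (arcs P)\<^sup>*" "B \<in> P" for x w B
    using that by induction (auto simp: arcs_in_block[OF partition_onD2[OF P]])
  show ?thesis
  proof (intro set_eqI iffI; clarify)
    fix x w assume "(x, w) \<in> chain_rel V (arcs P)"
    then have xy: "x \<in> V" "(x, w) \<in> (arcs P)\<^sup>* \<or> (w, x) \<in> (arcs P)\<^sup>*"
      by (auto simp: chain_rel_def)
    then obtain B where "B \<in> P" "x \<in> B"
      using partition_onD1[OF P] by auto
    with xy(2) stay show "\<exists>B\<in>P. x \<in> B \<and> w \<in> B"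
      by blast
  next
    fix x w B assume "B \<in> P" "x \<in> B" "w \<in> B"
    then show "(x, w) \<in> chain_rel V (arcs P)"
      using reach[of B x w] reach[of B w x] partition_onD1[OF P] linear[of x w]
      by (auto simp: chain_rel_def)
  qed
qed

lemma quotient_chain_rel_arcs:
  assumes "partition_on V P" "finite V"
  shows "V // chain_rel V (arcs P) = P"
  using chain_rel_arcs[OF assms] partition_on_eq_quotient[OF assms(1)] by simp

context
  fixes L R V :: "nat set" and A :: "(nat \<times> nat) set"
  assumes A: "A \<in> arc_diagrams L R" and L: "L \<subseteq> V" and R: "R \<subseteq> V"
begin

lemma arc_diagram_rtrancl_le: "(x, w) \<in> A\<^sup>* \<Longrightarrow> x \<le> w"
  by (induction rule: rtrancl_induct) (auto dest: arc_diagramsD(6)[OF A])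

lemma arc_diagram_rtrancl_comparable:
  "(x, w) \<in> A\<^sup>* \<Longrightarrow> (x, z) \<in> A\<^sup>* \<Longrightarrow> (w, z) \<in> A\<^sup>* \<or> (z, w) \<in> A\<^sup>*"
  using single_valued_confluent[of A x w z] A by (auto simp: arc_diagrams_def)

lemma arc_diagram_converse_rtrancl_comparable:
  assumes "(w, x) \<in> A\<^sup>*" "(z, x) \<in> A\<^sup>*"
  shows "(w, z) \<in> A\<^sup>* \<or> (z, w) \<in> A\<^sup>*"
  using single_valued_confluent[of "A\<inverse>" x w z] A assms
  by (auto simp: arc_diagrams_def rtrancl_converse)

text \<open>
  Only transitivity needs an argument. Two paths with the same start follow the same arcs, so one of
  them is an initial part of the other and their ends are joined by the remainder; the same holds
  backwards for two paths with the same end.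
\<close>

lemma equiv_chain_rel: "equiv V (chain_rel V A)"
proof (rule equivI)
  show "chain_rel V A \<subseteq> V \<times> V"
    by (auto simp: chain_rel_def)
  show "refl_on V (chain_rel V A)"
    by (auto simp: refl_on_def chain_rel_def)
  show "sym (chain_rel V A)"
    by (auto simp: sym_def chain_rel_def)
  show "trans (chain_rel V A)"
    using arc_diagram_rtrancl_comparable arc_diagram_converse_rtrancl_comparable
    unfolding trans_def chain_rel_def by (blast intro: rtrancl_trans)
qed

text \<open>
  Since arcs increase, the points beyond \<open>i\<close> in the chain of \<open>i\<close> are those reached through the
  arc that starts at \<open>i\<close>, and its end is the nearest of them. Hence consecutive elements of a
  chain are joined by an arc, and arcs join only consecutive elements.
\<close>

lemma arcs_quotient_chain_rel: "arcs (V // chain_rel V A) = A"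
proof -
  \<comment> \<open>The blocks are equivalence classes, so the block in the definition of an arc is the class of \<open>i\<close>.\<close>
  have block: "(\<exists>B\<in>V // chain_rel V A. i \<in> B \<and> j \<in> B \<and> (\<forall>k\<in>B. Q k)) \<longleftrightarrow>
      (i, j) \<in> chain_rel V A \<and> (\<forall>k. (i, k) \<in> chain_rel V A \<longrightarrow> Q k)" for i j Q
  proof
    assume "\<exists>B\<in>V // chain_rel V A. i \<in> B \<and> j \<in> B \<and> (\<forall>k\<in>B. Q k)"
    then show "(i, j) \<in> chain_rel V A \<and> (\<forall>k. (i, k) \<in> chain_rel V A \<longrightarrow> Q k)"
      using quotient_eq_iff[OF equiv_chain_rel] in_quotient_imp_closed[OF equiv_chain_rel] by metis
  next
    assume *: "(i, j) \<in> chain_rel V A \<and> (\<forall>k. (i, k) \<in> chain_rel V A \<longrightarrow> Q k)"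
    then have "i \<in> V"
      by (auto simp: chain_rel_def)
    then have "(i, i) \<in> chain_rel V A"
      by (simp add: chain_rel_def)
    with * \<open>i \<in> V\<close> show "\<exists>B\<in>V // chain_rel V A. i \<in> B \<and> j \<in> B \<and> (\<forall>k\<in>B. Q k)"
      by (intro bexI[of _ "chain_rel V A `` {i}"] quotientI) auto
  qed
  have up: "\<exists>z. (x, z) \<in> A \<and> (z, w) \<in> A\<^sup>*" if "(x, w) \<in> chain_rel V A" "x < w" for x w
  proof -
    have "(x, w) \<in> A\<^sup>*"
      using that arc_diagram_rtrancl_le[of w x] by (auto simp: chain_rel_def)
    then show ?thesis
      using \<open>x < w\<close> by (auto elim: converse_rtranclE)
  qed
  have A_rel: "(i, j) \<in> chain_rel V A" if "(i, j) \<in> A" for i j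
    using that L R arc_diagramsD(3)[OF A] by (auto simp: chain_rel_def)
  have "(i, j) \<in> arcs (V // chain_rel V A) \<longleftrightarrow> (i, j) \<in> A" for i j
  proof
    assume "(i, j) \<in> arcs (V // chain_rel V A)"
    then have ij: "i < j" "(i, j) \<in> chain_rel V A"
      and gap: "\<And>k. (i, k) \<in> chain_rel V A \<Longrightarrow> \<not> (i < k \<and> k < j)"
      using block by (auto simp: arcs_def)
    obtain z where z: "(i, z) \<in> A" "(z, j) \<in> A\<^sup>*"
      using up ij by blast
    have "z = j"
      using gap[OF A_rel[OF z(1)]] arc_diagram_rtrancl_le[OF z(2)] arc_diagramsD(6)[OF A z(1)]
      by simp
    with z show "(i, j) \<in> A"
      by simp
  next
    assume ij: "(i, j) \<in> A"
    have "\<not> (i < k \<and> k < j)" if ik: "(i, k) \<in> chain_rel V A" for k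
    proof
      assume k: "i < k \<and> k < j"
      then obtain z where "(i, z) \<in> A" "(z, k) \<in> A\<^sup>*"
        using up ik by blast
      then show False
        using arc_diagramsD(4)[OF A ij] arc_diagram_rtrancl_le[of j k] k by auto
    qed
    then show "(i, j) \<in> arcs (V // chain_rel V A)"
      using block[of i j "\<lambda>k. \<not> (i < k \<and> k < j)"] A_rel[OF ij] arc_diagramsD(6)[OF A ij]
      by (auto simp: arcs_def)
  qed
  then show ?thesis
    by auto
qed

end

section \<open>Partitions as arc diagrams\<close>

text \<open>
  The openers and closers of a diagram are its domain and its range; by \<open>Domain_arcs\<close> and
  \<open>Range_arcs\<close>, prescribing them amounts to prescribing the block maxima and minima.
\<close>

theorem bij_betw_arcs:
  assumes V: "finite V" and S: "S \<subseteq> V" and T: "T \<subseteq> V"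
  shows "bij_betw arcs {P. partition_on V P \<and> mins P = S \<and> maxs P = T}
    (arc_diagrams (V - T) (V - S))"
proof (rule bij_betw_byWitness[where f' = "\<lambda>A. V // chain_rel V A"])
  show "\<forall>P\<in>{P. partition_on V P \<and> mins P = S \<and> maxs P = T}. V // chain_rel V (arcs P) = P"
    using quotient_chain_rel_arcs V by blast
  show "\<forall>A\<in>arc_diagrams (V - T) (V - S). arcs (V // chain_rel V A) = A"
    using arcs_quotient_chain_rel by blast
  show "arcs ` {P. partition_on V P \<and> mins P = S \<and> maxs P = T} \<subseteq> arc_diagrams (V - T) (V - S)"
    using arcs_in_arc_diagrams V by blast
  show "(\<lambda>A. V // chain_rel V A) ` arc_diagrams (V - T) (V - S)
      \<subseteq> {P. partition_on V P \<and> mins P = S \<and> maxs P = T}"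
  proof clarify
    fix A assume A: "A \<in> arc_diagrams (V - T) (V - S)"
    let ?P = "V // chain_rel V A"
    have P: "partition_on V ?P"
      using equiv_chain_rel[OF A] by (intro partition_on_quotient) auto
    have "arcs ?P = A"
      using arcs_quotient_chain_rel[OF A] by auto
    then have "V - maxs ?P = V - T" "V - mins ?P = V - S"
      using Domain_arcs[OF P V] Range_arcs[OF P V] arc_diagramsD(1,2)[OF A] by auto
    moreover have "Max B \<in> V" "Min B \<in> V" if "B \<in> ?P" for B
    proof -
      have "finite B" "B \<noteq> {}" "B \<subseteq> V"
        using that partition_on_finite_block[OF P V] partition_onD3[OF P] partition_onD1[OF P]
        by auto
      then show "Max B \<in> V" "Min B \<in> V"
        using Max_in Min_in by blast+
    qed
    then have "maxs ?P \<subseteq> V" "mins ?P \<subseteq> V"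
      by (auto simp: maxs_def mins_def)
    ultimately show "partition_on V ?P \<and> mins ?P = S \<and> maxs ?P = T"
      using P S T by (metis double_diff order_refl)
  qed
qed

text \<open>
  Passing to complements in \<open>{i+1..n}\<close> exchanges the roles of \<open>S\<close> and \<open>T\<close>: the \<open>h\<close> of the
  statement is the number of candidates of the opener \<open>i\<close>.
\<close>

lemma h_eq_card_diff:
  assumes "S \<subseteq> {1..n}" "T \<subseteq> {1..n}"
  shows "h n S T i = int (card {j\<in>{1..n} - S. i < j}) - int (card {l\<in>{1..n} - T. i < l})"
proof -
  have "int (card {j\<in>{1..n} - X. i < j}) = int (card {i+1..n}) - int (card (X \<inter> {i+1..n}))" for X
  proof -
    have "{j\<in>{1..n} - X. i < j} = {i+1..n} - X \<inter> {i+1..n}"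
      by auto
    moreover have "card (X \<inter> {i+1..n}) \<le> card {i+1..n}"
      by (intro card_mono) auto
    ultimately show ?thesis
      by (simp only: card_Diff_subset[OF finite_Int[OF disjI2[OF finite_atLeastAtMost]] Int_lower2] of_nat_diff)
  qed
  then show ?thesis
    by (simp add: h_def)
qed

theorem theorem1:
  fixes n :: nat and S T :: "nat set"
  assumes "n \<ge> 1" and "S \<subseteq> {1..n}" and "T \<subseteq> {1..n}" and "card S = card T"
  shows "(\<Sum>P\<in>partitions_min_max n S T. y ^ cr2 P) =
    (\<Prod>i\<in>{1..n} - T. \<Sum>k | int k \<le> h n S T i - 1. y ^ k)"
proof -
  let ?V = "{1..n}"
  have "bij_betw arcs (partitions_min_max n S T) (arc_diagrams (?V - T) (?V - S))"
    using bij_betw_arcs[of ?V S T] assms(2,3)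
    by (simp add: partitions_min_max_def set_partitions_def conj_ac)
  then have "(\<Sum>P\<in>partitions_min_max n S T. y ^ cr2 P) =
      (\<Sum>A\<in>arc_diagrams (?V - T) (?V - S). y ^ card (crossings A))"
    unfolding cr2_eq_card_crossings by (rule sum.reindex_bij_betw)
  also have "\<dots> = (\<Prod>i\<in>?V - T. \<Sum>k<card {j\<in>?V - S. i < j} - card {l\<in>?V - T. i < l}. y ^ k)"
    using assms by (intro sum_crossings_arc_diagrams) (auto simp: card_Diff_subset finite_subset)
  also have "\<dots> = (\<Prod>i\<in>?V - T. \<Sum>k | int k \<le> h n S T i - 1. y ^ k)"
  proof (intro prod.cong sum.cong refl)
    fix i
    \<comment> \<open>If \<open>h\<close> is not positive, both index sets are empty, on the left by truncated subtraction.\<close>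
    show "{..<card {j\<in>?V - S. i < j} - card {l\<in>?V - T. i < l}} = {k. int k \<le> h n S T i - 1}"
      unfolding h_eq_card_diff[OF assms(2,3)] by auto
  qed
  finally show ?thesis .
qed

end
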